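(* Let $n\ge2$. Then (a) $P_n(0,0)=0$; (b) $P_n(1,0)=1$; (c) $2\mid P_n(0,1)$ if and only if $n=2^m$ for some $m\ge1$; (d) $2\mid P_n(1,1)$ if and only if $n=3\cdot2^m$ for some $m\ge0$.
   Context: Let $\Phi_n(q)$ be the $n$th cyclotomic polynomial and $\phi$ the Euler totient function. For $n\ge 2$, $\Phi_n(q)$ is palindromic of degree $\phi(n)$ with constant term $1$, so there are unique complex numbers $\gamma_j$ with $\Phi_n(q)=\sum_{0\le j\le \phi(n)/2}\gamma_j q^j(1+q)^{\phi(n)-2j}$; the $n$th Lucas atom is $P_n(s,t)=\sum_j \gamma_j s^{\phi(n)-2j}(-t)^j$ (a polynomial with integer coefficients). *)

theory Defs
  imports
    "HOL-Analysis.Analysis"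
    "HOL-Computational_Algebra.Polynomial"
    "HOL-Number_Theory.Totient"
begin

definition cyclotomic_poly :: "nat \<Rightarrow> complex poly" where
  "cyclotomic_poly n = (\<Prod>k\<in>totatives n. [:- cis (2 * pi * real k / real n), 1:])"

text \<open>The coefficients of the expansion of the cyclotomic polynomial in the polynomials
  \<open>q ^ j * (1 + q) ^ (totient n - 2 * j)\<close>, where \<open>0 \<le> j \<le> totient n / 2\<close>. Such coefficients
  exist and are unique for \<open>n \<ge> 2\<close>; those outside the range of \<open>j\<close> are set to \<open>0\<close> so that
  the sequence as a whole is unique. For \<open>n < 2\<close> the value is unspecified.\<close>

definition gamma_coeff :: "nat \<Rightarrow> nat \<Rightarrow> complex" where
  "gamma_coeff n = (THE \<gamma>.
     cyclotomic_poly n =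
       (\<Sum>j\<le>totient n div 2. smult (\<gamma> j) ([:0, 1:] ^ j * [:1, 1:] ^ (totient n - 2 * j))) \<and>
     (\<forall>j>totient n div 2. \<gamma> j = 0))"

text \<open>A polynomial in \<open>s\<close> and \<open>t\<close> is represented as a polynomial in \<open>s\<close> whose coefficients are
  polynomials in \<open>t\<close>. Below, \<open>[:0, - 1:]\<close> is the polynomial \<open>- t\<close>.\<close>

definition eval2 :: "'a::comm_semiring_0 poly poly \<Rightarrow> 'a \<Rightarrow> 'a \<Rightarrow> 'a" where
  "eval2 P s t = poly (poly P [:s:]) t"

definition complex_lucas_atom :: "nat \<Rightarrow> complex poly poly" where
  "complex_lucas_atom n =
     (\<Sum>j\<le>totient n div 2. monom (smult (gamma_coeff n j) ([:0, - 1:] ^ j)) (totient n - 2 * j))"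

text \<open>The polynomial above has integer coefficients for \<open>n \<ge> 2\<close>; the Lucas atom is this polynomial
  regarded as an element of \<open>\<int>[s, t]\<close>, so that divisibility of its values is divisibility of integers.\<close>

definition lucas_atom :: "nat \<Rightarrow> int poly poly" where
  "lucas_atom n = (THE P. map_poly (map_poly of_int) P = complex_lucas_atom n)"

end

theory Submission
  imports Defs "HOL-Number_Theory.Fib"
begin

text \<open>For \<open>s = X + Y\<close> and \<open>t = - (X * Y)\<close>, the factorization of \<open>q ^ n - 1\<close> into cyclotomic
  polynomials gives \<open>\<Prod>d | d dvd n \<and> d > 1. P\<^sub>d(s, t) = U\<^sub>n\<close>, where
  \<open>U\<^sub>n = (\<Sum>i<n. X ^ i * Y ^ (n - 1 - i))\<close> is the Lucas sequence of \<open>s, t\<close>. Since parity only depends on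
  \<open>s, t\<close> modulo 2, \<open>P\<^sub>n(0, 1)\<close> may be replaced by \<open>P\<^sub>n(2, - 1)\<close>, for which \<open>U\<^sub>n = n\<close> has
  no zeros; for \<open>P\<^sub>n(1, 1)\<close> the sequence consists of the Fibonacci numbers. In both cases
  \<open>U\<^sub>n\<close> is even iff \<open>r dvd n\<close> (with \<open>r = 2\<close> and \<open>r = 3\<close>), and if \<open>r dvd N\<close> then
  \<open>U\<^bsub>k N\<^esub> / U\<^sub>N\<close> has the parity of \<open>k\<close>. Comparing the factors that are new at \<open>n\<close> then shows
  that \<open>P\<^sub>n\<close> is even iff \<open>n = r * 2 ^ m\<close>.\<close>

section \<open>Parity of the factors in a product over divisors\<close>

text \<open>If \<open>r\<close> does not divide \<open>d\<close>, then \<open>a d\<close> is odd as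
  a divisor of the odd \<open>u d\<close>. For \<open>k dvd n\<close>, cancelling the nonzero
  \<open>u k\<close> identifies \<open>u n / u k\<close> with the product of \<open>a d\<close> over
  the divisors \<open>d\<close> of \<open>n\<close> that do not divide \<open>k\<close>. The
  assumption on quotients gives the parity of that product, with \<open>k\<close> chosen as
  \<open>r\<close> times a power of 2.\<close>

lemma even_factor_of_even_product_iff:
  fixes a u :: "nat \<Rightarrow> int" and r n :: nat
  assumes u: "\<And>k. k > 0 \<Longrightarrow> u k = (\<Prod>d | d dvd k. a d)"
    and nz: "\<And>k. k > 0 \<Longrightarrow> u k \<noteq> 0"
    and even_u: "\<And>k. k > 0 \<Longrightarrow> even (u k) \<longleftrightarrow> r dvd k"
    and quot: "\<And>k N. k > 0 \<Longrightarrow> N > 0 \<Longrightarrow> r dvd N \<Longrightarrow> \<exists>c. u (k * N) = u N * c \<and> (even c \<longleftrightarrow> even k)"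
    and "r > 0" "n > 0"
  shows "even (a n) \<longleftrightarrow> (\<exists>m. n = r * 2 ^ m)"
proof -
  have odd_a: "odd (a d)" if "d > 0" "\<not> r dvd d" for d
  proof -
    have "a d dvd u d"
      unfolding u[OF that(1)] using that by (intro dvd_prodI) auto
    then show ?thesis
      using even_u[OF that(1)] that(2) by (meson dvd_trans)
  qed
  have split: "u n = u k * (\<Prod>d | d dvd n \<and> \<not> d dvd k. a d)" if "k dvd n" "n > 0" for k n
  proof -
    have "k > 0" using that by (auto intro: Nat.gr0I)
    have "u n = (\<Prod>d\<in>{d. d dvd k} \<union> {d. d dvd n \<and> \<not> d dvd k}. a d)"
      unfolding u[OF that(2)] by (rule prod.cong) (use that in \<open>auto intro: dvd_trans\<close>)
    also have "\<dots> = u k * (\<Prod>d | d dvd n \<and> \<not> d dvd k. a d)"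
      unfolding u[OF \<open>k > 0\<close>] using that \<open>k > 0\<close> by (intro prod.union_disjoint) auto
    finally show ?thesis .
  qed
  have even_a: "even (a (r * 2 ^ m))" for m
  proof (rule ccontr)
    let ?N = "r * 2 ^ m"
    assume odd: "odd (a ?N)"
    have pos: "?N > 0" using \<open>r > 0\<close> by simp
    show False
    proof (cases m)
      case 0
      have "even (u r)" using even_u[of r] \<open>r > 0\<close> by simp
      then have "even (\<Prod>d | d dvd r. a d)" using u[of r] \<open>r > 0\<close> by simp
      then obtain d where d: "d dvd r" "even (a d)"
        using \<open>r > 0\<close> by (auto simp: even_prod_iff)
      then have "r dvd d" using odd_a[of d] \<open>r > 0\<close> by (auto intro: Nat.gr0I)
      with d have "d = r" by (simp add: dvd_antisym)
      with d odd 0 show False by simp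
    next
      case (Suc l)
      let ?M = "r * 2 ^ l"
      have M: "?M > 0" "?N = 2 * ?M" using \<open>r > 0\<close> Suc by auto
      obtain c where c: "u ?N = u ?M * c" "even c"
        using quot[of 2 ?M] M by auto
      have "u ?N = u ?M * (\<Prod>d | d dvd ?N \<and> \<not> d dvd ?M. a d)"
        by (rule split) (use \<open>r > 0\<close> Suc in simp_all)
      with c nz[OF M(1)] have "even (\<Prod>d | d dvd ?N \<and> \<not> d dvd ?M. a d)" by simp
      moreover have "finite {d. d dvd ?N \<and> \<not> d dvd ?M}" using pos by simp
      ultimately obtain d where d: "d dvd ?N" "\<not> d dvd ?M" "even (a d)"
        by (auto simp: even_prod_iff)
      have "d > 0" using d(1) pos by (auto intro: Nat.gr0I)
      \<comment> \<open>The even factor sits at a multiple of \<open>r\<close>, and the only such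
        divisor of \<open>?N\<close> not dividing \<open>?M\<close> is \<open>?N\<close>
        itself.\<close>
      with d odd_a[of d] obtain e where e: "d = r * e" by (auto elim: dvdE)
      with d \<open>r > 0\<close> have "e dvd 2 ^ Suc l" "\<not> e dvd 2 ^ l" by (auto simp: Suc)
      then obtain i where "i \<le> Suc l" "e = 2 ^ i"
        using divides_primepow_nat[OF two_is_prime_nat, of e "Suc l"] by blast
      with \<open>\<not> e dvd 2 ^ l\<close> have "e = 2 ^ m"
        using Suc by (cases "i = Suc l") (auto simp: le_imp_power_dvd)
      with d e odd show False by simp
    qed
  qed
  have odd_a': "odd (a n)" if r_n: "r dvd n" "\<nexists>m. n = r * 2 ^ m"
  proof -
    obtain q where q: "n = r * q" using r_n(1) by (rule dvdE)
    with \<open>n > 0\<close> have "q \<noteq> 0" by auto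
    \<comment> \<open>With \<open>k\<close> the odd part of \<open>n / r\<close>, the quotient
      \<open>u n / u ?N\<close> is odd, and \<open>a n\<close> is one of its factors because
      \<open>k > 1\<close>.\<close>
    then obtain m k where k: "odd k" "q = 2 ^ m * k"
      by (rule multiplicity_decompose'[of q 2]) (auto intro: that)
    let ?N = "r * 2 ^ m"
    have n: "n = k * ?N" using k q by simp
    have "k \<noteq> 1" "k > 0" using r_n(2) n k \<open>n > 0\<close> by (auto intro: Nat.gr0I)
    have N: "?N > 0" using \<open>r > 0\<close> by simp
    obtain c where c: "u n = u ?N * c" "odd c"
      using quot[of k ?N] N k n \<open>k > 0\<close> by auto
    have "u n = u ?N * (\<Prod>d | d dvd n \<and> \<not> d dvd ?N. a d)"
      using split[of ?N n] n \<open>n > 0\<close> by simp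
    with c nz[OF N] have "odd (\<Prod>d | d dvd n \<and> \<not> d dvd ?N. a d)" by simp
    moreover have "\<not> n dvd ?N"
      using dvd_imp_le[of n ?N] N n \<open>k \<noteq> 1\<close> \<open>k > 0\<close> by auto
    moreover have "finite {d. d dvd n \<and> \<not> d dvd ?N}" using \<open>n > 0\<close> by simp
    ultimately show ?thesis
      by (auto simp: even_prod_iff dest: spec[where x = n])
  qed
  show ?thesis
    using even_a odd_a' odd_a[OF \<open>n > 0\<close>] by auto
qed

section \<open>Parity of Fibonacci numbers and of their quotients\<close>

text \<open>\<open>gcd 2 (fib n)\<close> is \<open>fib (gcd 3 n)\<close>, which is
  \<open>fib 3 = 2\<close> or \<open>fib 1 = 1\<close>.\<close>

lemma even_fib_iff: "even (fib n) \<longleftrightarrow> 3 dvd n"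
proof -
  have [simp]: "fib 3 = 2" by (simp add: numeral_3_eq_3)
  have g: "fib (gcd 3 n) = gcd 2 (fib n)" using fib_gcd[of 3 n] by simp
  show ?thesis
  proof (cases "3 dvd n")
    case True
    then have "gcd 3 n = 3" by (simp add: gcd_nat.absorb1)
    with g have "gcd 2 (fib n) = 2" by simp
    with True show ?thesis by (metis gcd_dvd2)
  next
    case False
    then have "gcd 3 n = 1" using prime_imp_coprime[of 3 n] by (simp add: coprime_iff_gcd_eq_1)
    with g have "gcd 2 (fib n) = 1" by (simp only: fib_1)
    then have "odd (fib n)" using gcd_nat.absorb1[of 2 "fib n"] by (intro notI) simp
    with False show ?thesis by blast
  qed
qed

text \<open>The addition formula turns the cofactor \<open>c\<close> at \<open>k\<close> into
  \<open>fib (N + 1) * c + fib (k * N - 1)\<close> at \<open>k + 1\<close>. Both Fibonacci numbers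
  here are odd, being coprime to the even neighbours \<open>fib N\<close> and
  \<open>fib (k * N)\<close>, so the parity of the cofactor alternates.\<close>

lemma fib_mult_eq:
  assumes "even (fib N)" "N > 0" "k > 0"
  shows "\<exists>c. fib (k * N) = fib N * c \<and> (even c \<longleftrightarrow> even k)"
  using \<open>k > 0\<close>
proof (induction k rule: nat_induct_non_zero)
  case 1
  then show ?case by (auto intro: exI[of _ 1])
next
  case (Suc k)
  then obtain c where c: "fib (k * N) = fib N * c" "even c \<longleftrightarrow> even k" by auto
  obtain l where l: "k * N = Suc l" using \<open>N > 0\<close> Suc by (cases "k * N") auto
  have odd_Suc: "odd (fib (Suc N))"
    using coprime_fib_Suc_nat[of N] assms(1) by (metis coprime_common_divisor dvd_refl odd_one)
  have "odd (fib l)"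
    using coprime_fib_Suc_nat[of l] assms(1) c l
    by (metis coprime_common_divisor dvd_mult2 odd_one)
  have "fib (Suc k * N) = fib (Suc (l + N))"
    using l by (simp add: add.commute)
  also have "\<dots> = fib (Suc N) * fib (Suc l) + fib N * fib l" by (rule fib_add)
  also have "\<dots> = fib N * (fib (Suc N) * c + fib l)"
    using c l by (simp add: algebra_simps)
  finally show ?case
    using odd_Suc \<open>odd (fib l)\<close> c by (intro exI[of _ "fib (Suc N) * c + fib l"]) auto
qed

section \<open>Expansion of palindromic polynomials\<close>

text \<open>Above \<open>n\<close> both sides vanish, so the binomial theorem requires no bound on
  \<open>i\<close>.\<close>

lemma coeff_linear_power_binomial:
  fixes a b :: "'a::comm_semiring_1"
  shows "coeff ([:a, b:] ^ n) i = of_nat (n choose i) * b ^ i * a ^ (n - i)"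
proof (cases "i \<le> n")
  case False
  have "degree ([:a, b:] ^ n) \<le> n"
    by (rule order_trans[OF degree_power_le]) simp
  with False show ?thesis by (simp add: coeff_eq_0 binomial_eq_0)
qed (rule coeff_linear_poly_power)

text \<open>Subtracting \<open>coeff p 0\<close> times \<open>(1 + q) ^ d\<close> removes the
  coefficients at 0 and \<open>d\<close>; what remains is \<open>q\<close> times a polynomial
  symmetric with respect to \<open>d - 2\<close>, to which induction applies. The symmetry refers to
  \<open>d\<close> rather than to the degree because the degree of the remainder may drop
  further.\<close>

lemma palindromic_expansion:
  fixes p :: "'a::comm_ring_1 poly"
  assumes "degree p \<le> d" "\<And>i. i \<le> d \<Longrightarrow> coeff p (d - i) = coeff p i" "\<And>i. coeff p i \<in> \<int>"
  shows "\<exists>\<gamma>. (\<forall>j. \<gamma> j \<in> \<int>) \<and> (\<forall>j>d div 2. \<gamma> j = 0) \<and> \<gamma> 0 = coeff p 0 \<and>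
           p = (\<Sum>j\<le>d div 2. smult (\<gamma> j) ([:0, 1:] ^ j * [:1, 1:] ^ (d - 2 * j)))"
  using assms
proof (induction d arbitrary: p rule: less_induct)
  case (less d)
  let ?c = "coeff p 0"
  show ?case
  proof (cases "d < 2")
    case True
    have "p = smult ?c ([:1, 1:] ^ d)"
    proof (rule poly_eqI)
      fix i
      show "coeff p i = coeff (smult ?c ([:1, 1:] ^ d)) i"
      proof (cases "i \<le> d")
        case False
        then show ?thesis
          using less.prems(1) by (simp add: coeff_linear_power_binomial coeff_eq_0 binomial_eq_0)
      next
        case i: True
        with True have "i = 0 \<or> i = d" "d choose i = 1" by (auto simp: less_2_cases_iff le_Suc_eq)
        then show ?thesis
          using less.prems(2)[of 0] by (auto simp: coeff_linear_power_binomial)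
      qed
    qed
    with True less.prems(3) show ?thesis
      by (intro exI[of _ "\<lambda>j. if j = 0 then ?c else 0"]) auto
  next
    case False
    then obtain e where e: "d = e + 2" by (metis add.commute le_iff_add not_less)
    define q where "q = p - smult ?c ([:1, 1:] ^ d)"
    have q_sym: "coeff q (d - i) = coeff q i" if "i \<le> d" for i
      using that less.prems(2)[of i] by (simp add: q_def coeff_linear_power_binomial binomial_symmetric[of i d])
    have q0: "coeff q 0 = 0" by (simp add: q_def coeff_linear_power_binomial)
    then obtain r where r: "q = pCons 0 r" by (cases q) auto
    \<comment> \<open>At \<open>i = Suc e\<close> this is the coefficient of \<open>q\<close> at
      \<open>d\<close>, equal by symmetry to the one at 0.\<close>
    have "coeff r i = 0" if "i > e" for i
    proof (cases "i = Suc e")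
      case True
      then show ?thesis using q_sym[of 0] q0 by (simp add: r e coeff_pCons)
    next
      case False
      with that have "Suc i > d" using e by simp
      then have "coeff q (Suc i) = 0"
        using less.prems(1) by (simp add: q_def coeff_linear_power_binomial coeff_eq_0 binomial_eq_0)
      then show ?thesis by (simp add: r)
    qed
    then have "degree r \<le> e" by (intro degree_le) auto
    moreover have "coeff r (e - i) = coeff r i" if "i \<le> e" for i
      using that q_sym[of "Suc i"] by (simp add: r e Suc_diff_le)
    moreover have "coeff r i \<in> \<int>" for i
    proof -
      have "coeff q (Suc i) \<in> \<int>"
        unfolding q_def using less.prems(3) by (auto simp: coeff_linear_power_binomial intro!: Ints_diff Ints_mult)
      then show ?thesis by (simp add: r)
    qed
    ultimately obtain \<gamma> where \<gamma>: "\<forall>j. \<gamma> j \<in> \<int>" "\<forall>j>e div 2. \<gamma> j = 0"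
      "r = (\<Sum>j\<le>e div 2. smult (\<gamma> j) ([:0, 1:] ^ j * [:1, 1:] ^ (e - 2 * j)))"
      using less.IH[of e r] e by auto
    \<comment> \<open>Multiplication by the variable turns the basis element of index
      \<open>j\<close> for \<open>e\<close> into that of index \<open>j + 1\<close> for
      \<open>d\<close>, so the coefficients shift by one.\<close>
    define \<delta> where "\<delta> j = (case j of 0 \<Rightarrow> ?c | Suc i \<Rightarrow> \<gamma> i)" for j
    have "p = smult ?c ([:1, 1:] ^ d) + [:0, 1:] * r"
      using r by (simp add: q_def algebra_simps)
    also have "[:0, 1:] * r = (\<Sum>j\<le>e div 2. smult (\<gamma> j) ([:0, 1:] ^ Suc j * [:1, 1:] ^ (d - 2 * Suc j)))"
      unfolding \<gamma>(3) sum_distrib_left by (intro sum.cong refl) (simp add: e algebra_simps)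
    also have "smult ?c ([:1, 1:] ^ d) + \<dots> =
        (\<Sum>j\<le>d div 2. smult (\<delta> j) ([:0, 1:] ^ j * [:1, 1:] ^ (d - 2 * j)))"
      unfolding \<delta>_def e by (simp add: sum.atMost_Suc_shift del: power_Suc sum.atMost_Suc)
    finally show ?thesis
      using \<gamma> less.prems(3) e by (intro exI[of _ \<delta>]) (auto simp: \<delta>_def split: nat.splits)
  qed
qed

text \<open>The system is triangular: \<open>q ^ j * (1 + q) ^ e j\<close> starts with
  \<open>q ^ j\<close> and coefficient 1, so the coefficient at \<open>i\<close> is
  \<open>\<gamma> i\<close> plus a combination of earlier \<open>\<gamma> j\<close>.\<close>

lemma palindromic_expansion_unique:
  fixes \<gamma> \<delta> :: "nat \<Rightarrow> 'a::comm_ring_1"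
  assumes "(\<Sum>j\<le>m. smult (\<gamma> j) ([:0, 1:] ^ j * [:1, 1:] ^ (e j))) =
      (\<Sum>j\<le>m. smult (\<delta> j) ([:0, 1:] ^ j * [:1, 1:] ^ (e j)))" and "i \<le> m"
  shows "\<gamma> i = \<delta> i"
  using \<open>i \<le> m\<close>
proof (induction i rule: less_induct)
  case (less i)
  have x: "[:0, 1:] ^ j = monom (1::'a) j" for j by (simp add: monom_altdef)
  have eq: "coeff (\<Sum>j\<le>m. smult (\<eta> j) ([:0, 1:] ^ j * [:1, 1:] ^ (e j))) i =
      \<eta> i + (\<Sum>j<i. \<eta> j * coeff ([:1, 1:] ^ e j) (i - j))" for \<eta> :: "nat \<Rightarrow> 'a"
  proof -
    have "coeff (\<Sum>j\<le>m. smult (\<eta> j) ([:0, 1:] ^ j * [:1, 1:] ^ (e j))) i =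
      (\<Sum>j\<le>m. if j \<le> i then \<eta> j * coeff ([:1, 1:] ^ e j) (i - j) else 0)"
      by (auto simp: coeff_sum x coeff_monom_mult intro!: sum.cong)
    also have "\<dots> = (\<Sum>j\<le>i. \<eta> j * coeff ([:1, 1:] ^ e j) (i - j))"
      by (rule sum.mono_neutral_cong_right) (use less.prems in auto)
    finally show ?thesis
      by (simp add: lessThan_Suc_atMost[symmetric] coeff_linear_power_binomial)
  qed
  have "(\<Sum>j<i. \<gamma> j * coeff ([:1, 1:] ^ e j) (i - j)) = (\<Sum>j<i. \<delta> j * coeff ([:1, 1:] ^ e j) (i - j))"
    using less by (intro sum.cong) auto
  with eq[of \<gamma>] eq[of \<delta>] assms(1) show ?case by simp
qed

section \<open>Cyclotomic polynomials: factorization, integrality, symmetry\<close>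

lemma lead_coeff_cyclotomic_poly: "lead_coeff (cyclotomic_poly n) = 1"
  by (simp add: cyclotomic_poly_def lead_coeff_prod)

lemma degree_cyclotomic_poly: "degree (cyclotomic_poly n) = totient n"
  unfolding cyclotomic_poly_def totient_def by (subst degree_prod_sum_eq) auto

lemma cyclotomic_poly_1: "cyclotomic_poly 1 = [:-1, 1:]"
  by (simp add: cyclotomic_poly_def cis.ctr complex_eq_iff one_complex.code)

text \<open>Both sides are monic of degree \<open>n\<close>, as the totients of the divisors sum to
  \<open>n\<close>, and both vanish at the \<open>n\<close> roots of unity: writing
  \<open>k / n\<close> in lowest terms as \<open>k' / d\<close> shows which factor has the given
  root.\<close>

lemma prod_cyclotomic_poly:
  assumes "n > 0"
  shows "(\<Prod>d | d dvd n. cyclotomic_poly d) = monom 1 n - 1"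
proof (rule poly_eqI_degree_lead_coeff[where n = n and A = "{z. z ^ n = 1}"])
  let ?P = "\<Prod>d | d dvd n. cyclotomic_poly d"
  have "cyclotomic_poly d \<noteq> 0" for d
    using lead_coeff_cyclotomic_poly[of d] by auto
  then have deg: "degree ?P = n"
    by (subst degree_prod_sum_eq) (simp_all add: degree_cyclotomic_poly totient_divisor_sum)
  moreover have "lead_coeff ?P = 1"
    by (simp add: lead_coeff_prod lead_coeff_cyclotomic_poly)
  ultimately show "coeff ?P n = coeff (monom 1 n - 1) n" "degree ?P \<le> n"
    using assms by (simp_all add: coeff_1)
  show "degree (monom 1 n - 1 :: complex poly) \<le> n"
    by (intro degree_diff_le) (auto simp: degree_monom_le)
  show "n \<le> card {z::complex. z ^ n = 1}"
    using card_roots_unity_eq[OF assms] by simp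
  fix z :: complex assume z: "z \<in> {z. z ^ n = 1}"
  then obtain k0 where "k0 < n" "z = cis (2 * pi * real k0 / real n)"
    using Complex.bij_betw_roots_unity[OF assms] by (auto simp: bij_betw_def)
  \<comment> \<open>The root 1 is represented by \<open>k = n\<close> instead of 0, since totatives
    are positive.\<close>
  then obtain k where k: "k > 0" "k \<le> n" "z = cis (2 * pi * real k / real n)"
  proof (cases "k0 = 0")
    case True
    with assms \<open>z = _\<close> that[of n] show ?thesis by simp
  qed (use that[of k0] in auto)
  let ?g = "gcd k n"
  have g: "?g > 0" using assms by simp
  obtain k' d where kd: "k = k' * ?g" "n = d * ?g" "coprime k' d"
    using gcd_coprime_exists[of k n] g by auto
  have "k' \<in> totatives d"
    using kd k(1,2) by (metis in_totatives_iff mult_is_0 mult_le_cancel2 g not_gr0)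
  moreover have "z = cis (2 * pi * real k' / real d)"
  proof -
    have "real k / real n = real k' / real d"
      using g by (subst kd(1), subst (2) kd(2)) simp
    then show ?thesis using k(3) by (metis times_divide_eq_right)
  qed
  ultimately have "poly (cyclotomic_poly d) z = 0"
    by (auto simp: cyclotomic_poly_def poly_prod)
  moreover have "d dvd n" using kd(2) by (metis dvd_triv_left)
  ultimately show "poly ?P z = poly (monom 1 n - 1) z"
    using z assms by (auto simp: poly_prod poly_monom intro!: prod_zero)
qed

text \<open>The factor at \<open>d = 1\<close> is \<open>q - 1\<close>; cancelling it from
  \<open>q ^ n - 1\<close> leaves the geometric sum.\<close>

lemma prod_cyclotomic_poly_nontrivial:
  assumes "n > 0"
  shows "(\<Prod>d\<in>{d. d dvd n} - {1}. cyclotomic_poly d) = (\<Sum>i<n. monom 1 i)"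
proof -
  have "[:-1, 1:] * (\<Prod>d\<in>{d. d dvd n} - {1}. cyclotomic_poly d) = monom 1 n - 1"
    using assms prod_cyclotomic_poly[OF assms] prod.remove[of "{d. d dvd n}" 1 cyclotomic_poly]
    by (simp add: cyclotomic_poly_1[simplified])
  also have "\<dots> = [:-1, 1:] * (\<Sum>i<n. [:0, 1:] ^ i)"
  proof -
    have "[:-1, 1:] = - (1 - [:0, 1 :: complex:])" by (simp add: one_pCons)
    then show ?thesis
      using one_diff_power_eq[of "[:0, 1:] :: complex poly" n]
      by (metis minus_diff_eq minus_mult_left monom_altdef smult_1_left)
  qed
  finally show ?thesis
    by (simp add: monom_altdef del: mult_pCons_left)
qed

lemma coeff_geometric_poly: "coeff (\<Sum>i<n. monom 1 i) k = (if k < n then 1 else 0)"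
  by (auto simp: coeff_sum)

lemma reflect_geometric_poly:
  "reflect_poly (\<Sum>i<n. monom (1::'a::idom) i) = (\<Sum>i<n. monom 1 i)"
proof (cases n)
  case (Suc m)
  let ?p = "\<Sum>i<n. monom (1::'a) i"
  have "degree ?p = m"
  proof (rule antisym)
    show "degree ?p \<le> m" by (rule degree_le) (auto simp: coeff_geometric_poly Suc)
    show "m \<le> degree ?p" by (rule le_degree) (simp only: coeff_geometric_poly Suc, simp)
  qed
  then show ?thesis
    by (intro poly_eqI) (auto simp only: coeff_reflect_poly coeff_geometric_poly Suc, auto)
qed simp

lemma Ints_coeff_mult:
  fixes p q :: "'a::comm_ring_1 poly"
  assumes "\<And>i. coeff p i \<in> \<int>" "\<And>i. coeff q i \<in> \<int>"
  shows "coeff (p * q) i \<in> \<int>"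
  using assms by (auto simp: coeff_mult intro!: Ints_sum Ints_mult)

lemma Ints_coeff_prod:
  fixes f :: "'b \<Rightarrow> 'a::comm_ring_1 poly"
  assumes "\<And>x i. x \<in> A \<Longrightarrow> coeff (f x) i \<in> \<int>"
  shows "coeff (prod f A) i \<in> \<int>"
  using assms
proof (induction A arbitrary: i rule: infinite_finite_induct)
  case (insert x A)
  then show ?case by (simp add: Ints_coeff_mult)
qed (auto simp: coeff_1)

text \<open>As in division of power series, a constant term 1 yields a recursion for the
  coefficients of \<open>q\<close> without denominators.\<close>

lemma Ints_coeff_quotient:
  fixes p q :: "'a::comm_ring_1 poly"
  assumes "\<And>i. coeff (p * q) i \<in> \<int>" "\<And>i. coeff p i \<in> \<int>" "coeff p 0 = 1"
  shows "coeff q i \<in> \<int>"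
proof (induction i rule: less_induct)
  case (less i)
  have "coeff (p * q) i = (\<Sum>j\<in>insert 0 {1..i}. coeff p j * coeff q (i - j))"
    unfolding coeff_mult by (rule sum.cong) auto
  then have "coeff q i = coeff (p * q) i - (\<Sum>j\<in>{1..i}. coeff p j * coeff q (i - j))"
    using assms(3) by simp
  also have "\<dots> \<in> \<int>"
    using assms less by (intro Ints_diff Ints_sum Ints_mult) auto
  finally show ?case .
qed

text \<open>The product \<open>Q\<close> over the divisors other than 1 and \<open>n\<close> has all
  three properties by induction, and \<open>Q * cyclotomic_poly n\<close> is the geometric sum,
  which has them too; each passes to the cofactor. The case \<open>n = 1\<close> differs:
  \<open>q - 1\<close> is antipalindromic.\<close>

lemma cyclotomic_poly_integral_palindromic:
  assumes "n \<ge> 2"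
  shows "coeff (cyclotomic_poly n) 0 = 1 \<and> (\<forall>i. coeff (cyclotomic_poly n) i \<in> \<int>) \<and>
    reflect_poly (cyclotomic_poly n) = cyclotomic_poly n"
  using assms
proof (induction n rule: less_induct)
  case (less n)
  define D where "D = {d. d dvd n} - {1, n}"
  define Q where "Q = (\<Prod>d\<in>D. cyclotomic_poly d)"
  have IH: "coeff (cyclotomic_poly d) 0 = 1" "coeff (cyclotomic_poly d) i \<in> \<int>"
    "reflect_poly (cyclotomic_poly d) = cyclotomic_poly d" if "d \<in> D" for d i
  proof -
    have "d \<noteq> 0" "d \<noteq> 1" "d dvd n" "d \<noteq> n" using that less.prems by (auto simp: D_def)
    then have "d \<ge> 2" "d \<le> n" using less.prems by (simp_all add: dvd_imp_le)
    with \<open>d \<noteq> n\<close> have "d < n" by simp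
    with \<open>d \<ge> 2\<close> less.IH[of d] show "coeff (cyclotomic_poly d) 0 = 1" "coeff (cyclotomic_poly d) i \<in> \<int>"
      "reflect_poly (cyclotomic_poly d) = cyclotomic_poly d" by auto
  qed
  have "{d. d dvd n} - {1} = insert n D" "n \<notin> D" "finite D"
    using less.prems by (auto simp: D_def)
  then have eq: "Q * cyclotomic_poly n = (\<Sum>i<n. monom 1 i)"
    using prod_cyclotomic_poly_nontrivial[of n] less.prems by (simp add: Q_def mult.commute)
  have Q0: "coeff Q 0 = 1"
    using IH by (simp add: Q_def poly_0_coeff_0[symmetric] poly_prod)
  have Q_int: "coeff Q i \<in> \<int>" for i
    using IH by (auto simp: Q_def intro!: Ints_coeff_prod)
  have Q_refl: "reflect_poly Q = Q"
    using IH by (simp add: Q_def reflect_poly_prod)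
  have "coeff (Q * cyclotomic_poly n) 0 = 1"
    using less.prems by (simp only: eq coeff_geometric_poly) simp
  then have "coeff (cyclotomic_poly n) 0 = 1" using Q0 by (simp add: coeff_mult)
  moreover have "coeff (cyclotomic_poly n) i \<in> \<int>" for i
    by (rule Ints_coeff_quotient[of Q]) (simp_all only: eq coeff_geometric_poly Q_int Q0, auto)
  \<comment> \<open>Reflection is multiplicative, and \<open>Q\<close> can be cancelled since its
    constant term is 1.\<close>
  moreover have "Q * reflect_poly (cyclotomic_poly n) = Q * cyclotomic_poly n"
    by (metis Q_refl eq reflect_geometric_poly reflect_poly_mult)
  then have "reflect_poly (cyclotomic_poly n) = cyclotomic_poly n" using Q0 by auto
  ultimately show ?case by blast
qed

text \<open>This evaluates the definite description in \<open>gamma_coeff\<close>: palindromicity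
  gives existence, and triangularity together with the zero values outside the range gives
  uniqueness.\<close>

lemma cyclotomic_poly_expansion:
  assumes "n \<ge> 2"
  shows "cyclotomic_poly n =
       (\<Sum>j\<le>totient n div 2. smult (gamma_coeff n j) ([:0, 1:] ^ j * [:1, 1:] ^ (totient n - 2 * j)))"
    and "gamma_coeff n j \<in> \<int>"
    and "gamma_coeff n 0 = 1"
proof -
  let ?d = "totient n" and ?p = "cyclotomic_poly n"
  let ?Q = "\<lambda>\<gamma>. ?p = (\<Sum>j\<le>?d div 2. smult (\<gamma> j) ([:0, 1:] ^ j * [:1, 1:] ^ (?d - 2 * j))) \<and>
     (\<forall>j>?d div 2. \<gamma> j = 0)"
  note * = cyclotomic_poly_integral_palindromic[OF assms]
  have "coeff ?p (?d - i) = coeff ?p i" if "i \<le> ?d" for i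
    using * that coeff_reflect_poly[of ?p i] by (simp add: degree_cyclotomic_poly)
  then obtain \<gamma> where \<gamma>: "\<forall>j. \<gamma> j \<in> \<int>" "\<gamma> 0 = 1" "?Q \<gamma>"
    using palindromic_expansion[of ?p ?d] * by (auto simp: degree_cyclotomic_poly)
  have "gamma_coeff n = \<gamma>"
    unfolding gamma_coeff_def
  proof (rule the_equality)
    fix \<delta> assume \<delta>: "?Q \<delta>"
    show "\<delta> = \<gamma>"
    proof
      fix j
      show "\<delta> j = \<gamma> j"
      proof (cases "j \<le> ?d div 2")
        case True
        show ?thesis
          by (rule palindromic_expansion_unique[OF _ True],
              rule trans[OF conjunct1[OF \<delta>, symmetric] conjunct1[OF \<gamma>(3)]])
      qed (use \<delta> \<gamma> in auto)
    qed
  qed (fact \<gamma>)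
  with \<gamma> show "gamma_coeff n j \<in> \<int>" "gamma_coeff n 0 = 1"
    "?p = (\<Sum>j\<le>?d div 2. smult (gamma_coeff n j) ([:0, 1:] ^ j * [:1, 1:] ^ (?d - 2 * j)))"
    by auto
qed

section \<open>Lucas atoms as homogenized cyclotomic polynomials\<close>

text \<open>Integrality of the \<open>gamma_coeff n j\<close> provides an integer preimage of
  \<open>complex_lucas_atom n\<close>, and coefficientwise embedding is injective, so the
  description in \<open>lucas_atom\<close> denotes that preimage.\<close>

lemma of_int_eval2_lucas_atom:
  assumes "n \<ge> 2"
  shows "of_int (eval2 (lucas_atom n) s t) =
    (\<Sum>j\<le>totient n div 2. gamma_coeff n j * of_int s ^ (totient n - 2 * j) * (- of_int t) ^ j)"
proof -
  have "\<exists>k. of_int k = gamma_coeff n j" for j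
    using cyclotomic_poly_expansion(2)[OF assms, of j] by (auto elim!: Ints_cases)
  then obtain g :: "nat \<Rightarrow> int" where g: "\<And>j. of_int (g j) = gamma_coeff n j" by metis
  let ?P = "\<Sum>j\<le>totient n div 2. monom (smult (g j) ([:0, - 1:] ^ j)) (totient n - 2 * j)"
  have "map_poly (map_poly of_int) ?P = complex_lucas_atom n"
    unfolding complex_lucas_atom_def
    by (auto simp: coeff_map_poly coeff_sum coeff_monom coeff_linear_power_binomial g
        intro!: poly_eqI sum.cong)
  moreover have "R = S" if "map_poly (map_poly of_int) R = (map_poly (map_poly of_int) S :: complex poly poly)"
    for R S :: "int poly poly"
  proof (intro poly_eqI)
    fix i k
    have "coeff (coeff (map_poly (map_poly of_int) R) i) k =
        (coeff (coeff (map_poly (map_poly of_int) S) i) k :: complex)" by (simp only: that)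
    then show "coeff (coeff R i) k = coeff (coeff S i) k" by (simp add: coeff_map_poly)
  qed
  ultimately have eq: "lucas_atom n = ?P"
    unfolding lucas_atom_def by (intro the_equality) metis+
  show ?thesis
    unfolding eq eval2_def by (simp add: poly_sum poly_monom g mult_ac)
qed

lemma poly_cong_int:
  fixes p :: "int poly"
  assumes "[x = y] (mod m)"
  shows "[poly p x = poly p y] (mod m)"
proof (induction p)
  case (pCons a p)
  show ?case using cong_add[OF cong_refl cong_mult[OF assms pCons.IH]] by simp
qed simp

text \<open>Used to move from \<open>(0, 1)\<close>, where the Lucas sequence has zeros, to the
  point \<open>(2, - 1)\<close> congruent modulo 2.\<close>

lemma eval2_cong:
  fixes P :: "int poly poly"
  assumes "[s = s'] (mod m)" "[t = t'] (mod m)"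
  shows "[eval2 P s t = eval2 P s' t'] (mod m)"
proof (induction P)
  case (pCons p P)
  show ?case
    using cong_add[OF poly_cong_int[OF assms(2), of p] cong_mult[OF assms(1) pCons.IH]]
    by (simp add: eval2_def)
qed (simp add: eval2_def)

text \<open>Substitute \<open>q = X / Y\<close> in the expansion and distribute
  \<open>Y ^ totient n\<close>: two factors \<open>Y\<close> turn each \<open>q\<close> into
  \<open>X * Y = - t\<close>, and one turns each \<open>1 + q\<close> into
  \<open>X + Y = s\<close>.\<close>

lemma lucas_atom_eq_homogenized_cyclotomic:
  fixes X Y :: complex
  assumes "n \<ge> 2" "X + Y = of_int s" "X * Y = - of_int t" "Y \<noteq> 0"
  shows "of_int (eval2 (lucas_atom n) s t) = Y ^ totient n * poly (cyclotomic_poly n) (X / Y)"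
proof -
  let ?d = "totient n"
  have "Y ^ ?d * poly (cyclotomic_poly n) (X / Y) =
      (\<Sum>j\<le>?d div 2. gamma_coeff n j * (Y ^ ?d * (X / Y) ^ j * (1 + X / Y) ^ (?d - 2 * j)))"
    by (subst cyclotomic_poly_expansion(1)[OF assms(1)])
      (simp add: poly_sum sum_distrib_left algebra_simps)
  also have "\<dots> = (\<Sum>j\<le>?d div 2. gamma_coeff n j * ((X * Y) ^ j * (X + Y) ^ (?d - 2 * j)))"
  proof (rule sum.cong[OF refl], rule arg_cong2[OF refl, where f = "(*)"])
    fix j assume "j \<in> {..?d div 2}"
    then obtain e where e: "?d = j + j + e"
      by (metis atMost_iff le_Suc_ex less_eq_div_iff_mult_less_eq mult_2_right zero_less_numeral)
    have "Y ^ ?d * (X / Y) ^ j * (1 + X / Y) ^ e = (Y * Y * (X / Y)) ^ j * (Y * (1 + X / Y)) ^ e"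
      by (simp only: e power_add power_mult_distrib mult_ac)
    also have "\<dots> = (X * Y) ^ j * (X + Y) ^ e"
    proof -
      have "Y * Y * (X / Y) = X * Y" "Y * (1 + X / Y) = X + Y"
        using assms(4) by (simp_all add: field_simps)
      then show ?thesis by simp
    qed
    finally show "Y ^ ?d * (X / Y) ^ j * (1 + X / Y) ^ (?d - 2 * j) = (X * Y) ^ j * (X + Y) ^ (?d - 2 * j)"
      by (simp add: e)
  qed
  also have "\<dots> = of_int (eval2 (lucas_atom n) s t)"
    by (simp add: of_int_eval2_lucas_atom assms(1-3) mult_ac)
  finally show ?thesis by simp
qed

text \<open>The totients of the divisors other than 1 sum to \<open>n - 1\<close>, so the powers of
  \<open>Y\<close> combine to homogenize the geometric sum.\<close>

lemma prod_lucas_atom: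
  fixes X Y :: complex
  assumes "n > 0" "X + Y = of_int s" "X * Y = - of_int t" "Y \<noteq> 0"
  shows "(\<Prod>d\<in>{d. d dvd n} - {1}. of_int (eval2 (lucas_atom d) s t)) = (\<Sum>i<n. X ^ i * Y ^ (n - Suc i))"
proof -
  let ?D = "{d. d dvd n} - {1}"
  have "totient 1 + sum totient ?D = n"
    using assms(1) totient_divisor_sum[of n] sum.remove[of "{d. d dvd n}" 1 totient] by simp
  then have deg: "sum totient ?D = n - 1" by simp
  have "(\<Prod>d\<in>?D. of_int (eval2 (lucas_atom d) s t)) =
      (\<Prod>d\<in>?D. Y ^ totient d * poly (cyclotomic_poly d) (X / Y))"
  proof (rule prod.cong[OF refl])
    fix d assume "d \<in> ?D"
    then have "d \<noteq> 0" "d \<noteq> 1" using assms(1) by auto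
    then have "d \<ge> 2" by simp
    then show "of_int (eval2 (lucas_atom d) s t) = Y ^ totient d * poly (cyclotomic_poly d) (X / Y)"
      using assms by (intro lucas_atom_eq_homogenized_cyclotomic)
  qed
  also have "\<dots> = Y ^ (n - 1) * poly (\<Prod>d\<in>?D. cyclotomic_poly d) (X / Y)"
    by (simp only: prod.distrib power_sum[symmetric] deg poly_prod)
  also have "\<dots> = (\<Sum>i<n. Y ^ (n - 1) * (X / Y) ^ i)"
    using assms(1) by (simp only: prod_cyclotomic_poly_nontrivial) (simp add: poly_sum poly_monom sum_distrib_left)
  also have "\<dots> = (\<Sum>i<n. X ^ i * Y ^ (n - Suc i))"
  proof (rule sum.cong[OF refl])
    fix i assume "i \<in> {..<n}"
    then obtain e where "n = Suc (i + e)" by (auto simp: less_iff_Suc_add)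
    then show "Y ^ (n - 1) * (X / Y) ^ i = X ^ i * Y ^ (n - Suc i)"
      using assms(4) by (simp add: power_add field_simps)
  qed
  finally show ?thesis .
qed

section \<open>Parity of Lucas atoms at the special points\<close>

lemma even_lucas_atom_iff:
  fixes X Y :: complex and u :: "nat \<Rightarrow> nat"
  assumes XY: "X + Y = of_int s" "X * Y = - of_int t" "Y \<noteq> 0"
    and u: "\<And>k. of_nat (u k) = (\<Sum>i<k. X ^ i * Y ^ (k - Suc i))"
    and nz: "\<And>k. k > 0 \<Longrightarrow> u k > 0"
    and even_u: "\<And>k. k > 0 \<Longrightarrow> even (u k) \<longleftrightarrow> r dvd k"
    and quot: "\<And>k N. k > 0 \<Longrightarrow> N > 0 \<Longrightarrow> r dvd N \<Longrightarrow> \<exists>c. u (k * N) = u N * c \<and> (even c \<longleftrightarrow> even k)"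
    and "r > 0" "n \<ge> 2"
  shows "even (eval2 (lucas_atom n) s t) \<longleftrightarrow> (\<exists>m. n = r * 2 ^ m)"
proof -
  \<comment> \<open>At \<open>d = 1\<close>, where \<open>lucas_atom\<close> is unspecified, the
    value 1 leaves the product over all divisors unchanged.\<close>
  define a where "a d = (if d = 1 then 1 else eval2 (lucas_atom d) s t)" for d
  have "even (a n) \<longleftrightarrow> (\<exists>m. n = r * 2 ^ m)"
  proof (rule even_factor_of_even_product_iff[where u = "\<lambda>k. int (u k)"])
    fix k :: nat assume k: "k > 0"
    have "(\<Prod>d | d dvd k. a d) = (\<Prod>d\<in>{d. d dvd k} - {1}. eval2 (lucas_atom d) s t)"
      using k by (subst prod.remove[of _ 1]) (auto simp: a_def)
    then have "of_int (\<Prod>d | d dvd k. a d) = (of_int (int (u k)) :: complex)"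
      using prod_lucas_atom[OF k XY] u[of k] by simp
    then show "int (u k) = (\<Prod>d | d dvd k. a d)" by (simp only: of_int_eq_iff)
  next
    fix k N :: nat assume "k > 0" "N > 0" "r dvd N"
    from quot[OF this] obtain c where "u (k * N) = u N * c" "even c \<longleftrightarrow> even k" by blast
    then show "\<exists>c. int (u (k * N)) = int (u N) * c \<and> (even c \<longleftrightarrow> even k)"
      by (intro exI[of _ "int c"]) simp
  qed (use nz even_u \<open>r > 0\<close> \<open>n \<ge> 2\<close> in \<open>auto dest: nz\<close>)
  then show ?thesis using \<open>n \<ge> 2\<close> by (simp add: a_def)
qed

text \<open>For \<open>X = Y = 1\<close> the sum has \<open>k\<close> terms equal to 1, so
  \<open>u k = k\<close> and the cofactor of \<open>u N\<close> in \<open>u (k * N)\<close> is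
  \<open>k\<close> itself.\<close>

lemma even_lucas_atom_2_minus_1_iff:
  assumes "n \<ge> 2"
  shows "even (eval2 (lucas_atom n) 2 (- 1)) \<longleftrightarrow> (\<exists>m. n = 2 * 2 ^ m)"
  by (rule even_lucas_atom_iff[where X = 1 and Y = 1 and u = "\<lambda>k. k"]) (use assms in auto)

text \<open>Here \<open>X\<close> and \<open>Y\<close> are the golden ratio and its conjugate, and
  Binet's formula identifies the sum with \<open>fib k\<close>.\<close>

lemma even_lucas_atom_1_1_iff:
  assumes "n \<ge> 2"
  shows "even (eval2 (lucas_atom n) 1 1) \<longleftrightarrow> (\<exists>m. n = 3 * 2 ^ m)"
proof (rule even_lucas_atom_iff[where u = fib])
  define \<phi> \<psi> :: real where "\<phi> = (1 + sqrt 5) / 2" and "\<psi> = (1 - sqrt 5) / 2"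
  have diff: "\<phi> - \<psi> = sqrt 5" by (simp add: \<phi>_def \<psi>_def field_simps)
  have "\<phi> + \<psi> = 1" by (simp add: \<phi>_def \<psi>_def field_simps)
  then show "of_real \<phi> + of_real \<psi> = (of_int 1 :: complex)"
    by (metis of_int_1 of_real_1 of_real_add)
  have *: "\<phi> * \<psi> = - 1" by (simp add: \<phi>_def \<psi>_def field_simps)
  then show "of_real \<phi> * of_real \<psi> = - (of_int 1 :: complex)"
    by (metis of_int_1 of_real_1 of_real_minus of_real_mult)
  show "of_real \<psi> \<noteq> (0 :: complex)" using * by auto
  fix k
  have "sqrt 5 * real (fib k) = \<phi> ^ k - \<psi> ^ k"
    using fib_closed_form[of k] by (simp add: \<phi>_def \<psi>_def)
  also have "\<dots> = sqrt 5 * (\<Sum>i<k. \<phi> ^ i * \<psi> ^ (k - Suc i))"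
    unfolding diff[symmetric] by (simp add: diff_power_eq_sum power_diff_sumr2 mult.commute)
  finally have "real (fib k) = (\<Sum>i<k. \<phi> ^ i * \<psi> ^ (k - Suc i))" by simp
  then have "complex_of_real (real (fib k)) = of_real (\<Sum>i<k. \<phi> ^ i * \<psi> ^ (k - Suc i))" by simp
  then show "of_nat (fib k) = (\<Sum>i<k. of_real \<phi> ^ i * (of_real \<psi> :: complex) ^ (k - Suc i))" by simp
qed (use assms even_fib_iff fib_mult_eq fib_neq_0_nat in auto)

theorem theorem6p3:
  fixes n :: nat
  assumes "n \<ge> 2"
  shows "eval2 (lucas_atom n) 0 0 = 0 \<and>
    eval2 (lucas_atom n) 1 0 = 1 \<and>
    (2 dvd eval2 (lucas_atom n) 0 1 \<longleftrightarrow> (\<exists>m\<ge>1. n = 2 ^ m)) \<and>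
    (2 dvd eval2 (lucas_atom n) 1 1 \<longleftrightarrow> (\<exists>m\<ge>0. n = 3 * 2 ^ m))"
proof -
  let ?d = "totient n"
  \<comment> \<open>Positivity makes the summand \<open>j = 0\<close> vanish through
    \<open>0 ^ ?d\<close>; the others vanish through \<open>0 ^ j\<close>.\<close>
  have "?d > 0" using assms by simp
  then have "complex_of_int (eval2 (lucas_atom n) 0 0) = 0"
    unfolding of_int_eval2_lucas_atom[OF assms] by (intro sum.neutral) (auto simp: power_0_left)
  then have "eval2 (lucas_atom n) 0 0 = 0" by simp
  \<comment> \<open>Only \<open>j = 0\<close> survives at \<open>t = 0\<close>, leaving
    \<open>gamma_coeff n 0 = 1\<close>.\<close>
  moreover have "complex_of_int (eval2 (lucas_atom n) 1 0) = 1"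
    unfolding of_int_eval2_lucas_atom[OF assms]
    by (simp add: power_0_left if_distrib cyclotomic_poly_expansion(3)[OF assms] cong: if_cong)
  then have "eval2 (lucas_atom n) 1 0 = 1" by simp
  moreover have "2 dvd eval2 (lucas_atom n) 0 1 \<longleftrightarrow> (\<exists>m\<ge>1. n = 2 ^ m)"
  proof -
    have "[eval2 (lucas_atom n) 0 1 = eval2 (lucas_atom n) 2 (- 1)] (mod 2)"
      by (rule eval2_cong) (auto simp: cong_def)
    then have "2 dvd eval2 (lucas_atom n) 0 1 \<longleftrightarrow> 2 dvd eval2 (lucas_atom n) 2 (- 1)"
      by (rule cong_dvd_iff)
    also have "\<dots> \<longleftrightarrow> (\<exists>m. n = 2 ^ Suc m)"
      using even_lucas_atom_2_minus_1_iff[OF assms] by simp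
    also have "\<dots> \<longleftrightarrow> (\<exists>m\<ge>1. n = 2 ^ m)"
      by (metis One_nat_def Suc_le_D le_add1 plus_1_eq_Suc)
    finally show ?thesis .
  qed
  ultimately show ?thesis using even_lucas_atom_1_1_iff[OF assms] by auto
qed

end
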